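(* Let $\{x_{mn}\}$ be a double sequence in a probabilistic normed space $(X,\vartheta,\diamond)$ which is statistically convergent to some $\eta\in X$ with respect to the probabilistic norm $\vartheta$. Then $\Lambda^{r}_{(x_{mn})}(st_2^\vartheta)=st_2^\vartheta\text{-}LIM^{r}_{x_{mn}}$ for some $r>0$.
   Context: A $t$-norm is a continuous map $\diamond:[0,1]\times[0,1]\to[0,1]$ that is commutative, associative, satisfies $a\diamond 1=a$, and satisfies $a\diamond b\ge c\diamond d$ whenever $a\ge c$, $b\ge d$. A distribution function is a nondecreasing, left continuous function $f:\mathbb{R}\to[0,\infty)$ with $\inf_t f(t)=0$ and $\sup_t f(t)=1$; $D$ denotes the set of all of them. A probabilistic normed space (PNS) is a triple $(X,\vartheta,\diamond)$ where $X$ is a real vector space with zero element $\theta$, $\diamond$ is a $t$-norm, and $\vartheta:X\to D$ (with $\vartheta(x;t)$ the value of $\vartheta(x)$ at $t\in\mathbb{R}$) satisfies: (1) $\vartheta(x;0)=0$; (2) $\vartheta(x;t)=1$ for all $t>0$ iff $x=\theta$; (3) $\vartheta(\alpha x;t)=\vartheta(x;t/|\alpha|)$ for all real $\alpha\ne0$ and $t>0$; (4) $\vartheta(x+y;s+t)\ge\vartheta(x;t)\diamond\vartheta(y;s)$ for all $x,y\in X$ and $s,t\ge0$. The double natural density of $K\subseteq\mathbb{N}\times\mathbb{N}$ is $\delta_2(K)=\lim_{m,n\to\infty}\frac{|\{(i,j)\in K:\ i\le m,\ j\le n\}|}{mn}$. $\{x_{mn}\}$ is statistically convergent to $\xi$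 with respect to $\vartheta$ if for every $\varepsilon>0$ and $\lambda\in(0,1)$, $\delta_2(\{(m,n):\vartheta(x_{mn}-\xi;\varepsilon)\le1-\lambda\})=0$. For $r\geq 0$, $\{x_{mn}\}$ is rough statistically convergent to $\beta\in X$ (and $\beta$ is an $r\text{-}st_2^\vartheta$-limit) if for every $\varepsilon>0$ and $\lambda\in(0,1)$, $\delta_2(\{(m,n):\vartheta(x_{mn}-\beta;r+\varepsilon)\le1-\lambda\})=0$. The set of all such $\beta$ is $st_2^\vartheta\text{-}LIM^{r}_{x_{mn}}$. For $r>0$, $\xi\in X$ is a rough statistical cluster point of $\{x_{mn}\}$ if for every $\varepsilon>0$ and $\lambda\in(0,1)$, $\delta_2(\{(m,n):\vartheta(x_{mn}-\xi;r+\varepsilon)>1-\lambda\})>0$. The set of all of them is $\Lambda^{r}_{(x_{mn})}(st_2^\vartheta)$. *)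

theory Defs
  imports "HOL-Analysis.Analysis"
begin

text \<open>A \<open>t\<close>-norm lives on the unit interval; its values outside \<open>[0,1] \<times> [0,1]\<close> are unconstrained.\<close>

locale t_norm =
  fixes T :: "real \<Rightarrow> real \<Rightarrow> real"
  assumes closed: "\<lbrakk>a \<in> {0..1}; b \<in> {0..1}\<rbrakk> \<Longrightarrow> T a b \<in> {0..1}"
    and continuous: "continuous_on ({0..1} \<times> {0..1}) (\<lambda>(a, b). T a b)"
    and commute: "\<lbrakk>a \<in> {0..1}; b \<in> {0..1}\<rbrakk> \<Longrightarrow> T a b = T b a"
    and assoc: "\<lbrakk>a \<in> {0..1}; b \<in> {0..1}; c \<in> {0..1}\<rbrakk> \<Longrightarrow> T (T a b) c = T a (T b c)"
    and right_unit: "a \<in> {0..1} \<Longrightarrow> T a 1 = a"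
    and mono: "\<lbrakk>a \<in> {0..1}; b \<in> {0..1}; c \<in> {0..1}; d \<in> {0..1}; c \<le> a; d \<le> b\<rbrakk>
      \<Longrightarrow> T c d \<le> T a b"

text \<open>Boundedness above is stated explicitly because \<open>SUP\<close> on \<^typ>\<open>real\<close> is
  unspecified for unbounded sets.\<close>

definition distribution_functions :: "(real \<Rightarrow> real) set" where
  "distribution_functions =
    {f. mono f \<and> (\<forall>t. continuous (at_left t) f) \<and> (\<forall>t. 0 \<le> f t) \<and>
        bdd_above (range f) \<and> (INF t. f t) = 0 \<and> (SUP t. f t) = 1}"

locale prob_normed_space = t_norm T
  for \<nu> :: "'a::real_vector \<Rightarrow> real \<Rightarrow> real" and T :: "real \<Rightarrow> real \<Rightarrow> real" +
  assumes distribution: "\<nu> x \<in> distribution_functions"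
    and at_zero: "\<nu> x 0 = 0"
    and eq_one_iff: "(\<forall>t>0. \<nu> x t = 1) \<longleftrightarrow> x = 0"
    and scale: "\<lbrakk>\<alpha> \<noteq> 0; 0 < t\<rbrakk> \<Longrightarrow> \<nu> (\<alpha> *\<^sub>R x) t = \<nu> x (t / \<bar>\<alpha>\<bar>)"
    and triangle: "\<lbrakk>0 \<le> s; 0 \<le> t\<rbrakk> \<Longrightarrow> T (\<nu> x t) (\<nu> y s) \<le> \<nu> (x + y) (s + t)"

text \<open>Indices start at 1, so entries with an index 0 play no role. The limit is the
  Pringsheim double limit (\<open>m\<close> and \<open>n\<close> tend to infinity independently). The density is a
  relation, since the limit need not exist; accordingly \<open>\<delta>\<^sub>2(K) > 0\<close> below means that
  the limit exists and is positive.\<close>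

definition has_double_density :: "(nat \<times> nat) set \<Rightarrow> real \<Rightarrow> bool" where
  "has_double_density K d \<longleftrightarrow>
    ((\<lambda>(m, n). real (card (K \<inter> ({1..m} \<times> {1..n}))) / (real m * real n)) \<longlongrightarrow> d)
      (sequentially \<times>\<^sub>F sequentially)"

definition stat_convergent ::
  "('a::real_vector \<Rightarrow> real \<Rightarrow> real) \<Rightarrow> (nat \<Rightarrow> nat \<Rightarrow> 'a) \<Rightarrow> 'a \<Rightarrow> bool" where
  "stat_convergent \<nu> x \<xi> \<longleftrightarrow>
    (\<forall>\<epsilon>>0. \<forall>l\<in>{0<..<1}. has_double_density {(m, n). \<nu> (x m n - \<xi>) \<epsilon> \<le> 1 - l} 0)"

definition rough_stat_limits ::
  "('a::real_vector \<Rightarrow> real \<Rightarrow> real) \<Rightarrow> real \<Rightarrow> (nat \<Rightarrow> nat \<Rightarrow> 'a) \<Rightarrow> 'a set" where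
  "rough_stat_limits \<nu> r x =
    {\<beta>. \<forall>\<epsilon>>0. \<forall>l\<in>{0<..<1}.
      has_double_density {(m, n). \<nu> (x m n - \<beta>) (r + \<epsilon>) \<le> 1 - l} 0}"

definition rough_stat_cluster_points ::
  "('a::real_vector \<Rightarrow> real \<Rightarrow> real) \<Rightarrow> real \<Rightarrow> (nat \<Rightarrow> nat \<Rightarrow> 'a) \<Rightarrow> 'a set" where
  "rough_stat_cluster_points \<nu> r x =
    {\<xi>. \<forall>\<epsilon>>0. \<forall>l\<in>{0<..<1}.
      \<exists>d>0. has_double_density {(m, n). \<nu> (x m n - \<xi>) (r + \<epsilon>) > 1 - l} d}"

end

theory Submission imports Defs begin

text \<open>If \<open>\<xi>\<close> is a rough cluster point, then indices \<open>(m, n)\<close> at which \<open>x m n\<close> is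
  \<open>r\<close>-close to \<open>\<xi>\<close> with probability above \<open>1 - l\<close> and close to \<open>\<eta>\<close> with probability
  above \<open>1 - l\<close> exist for every \<open>l\<close>, because a set of positive density meets every set whose
  complement has density zero. Hence \<open>\<nu> (\<eta> - \<xi>) (r + \<epsilon>) \<ge> T (1 - l) (1 - l)\<close>, and continuity
  of \<open>T\<close> at \<open>(1, 1)\<close> gives \<open>\<nu> (\<eta> - \<xi>) (r + \<epsilon>) = 1\<close>. As \<open>1\<close> is the unit of \<open>T\<close>, statistical
  convergence to \<open>\<eta>\<close> then makes \<open>\<xi>\<close> a rough limit. The converse holds because the complement
  of a density-zero set has density one.\<close>

abbreviation density_ratio :: "(nat \<times> nat) set \<Rightarrow> nat \<times> nat \<Rightarrow> real" where
  "density_ratio K \<equiv> \<lambda>(m, n). real (card (K \<inter> ({1..m} \<times> {1..n}))) / (real m * real n)"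

text \<open>The product filter is nontrivial, so limits along it are unique. This is what makes
  density zero and positive density mutually exclusive.\<close>

lemma has_double_density_unique:
  assumes "has_double_density K a" "has_double_density K b"
  shows "a = b"
  using assms unfolding has_double_density_def
  by (rule tendsto_unique[rotated]) (simp add: prod_filter_eq_bot)

lemma has_double_density_zero_subset:
  assumes "has_double_density B 0" "A \<subseteq> B"
  shows "has_double_density A 0"
proof -
  let ?F = "sequentially \<times>\<^sub>F sequentially"
  have "density_ratio A p \<le> density_ratio B p" for p
    using assms(2) by (auto simp: split_def intro!: divide_right_mono card_mono)
  then have upper: "\<forall>\<^sub>F p in ?F. density_ratio A p \<le> density_ratio B p"
    by (rule always_eventually[OF allI])
  have "0 \<le> density_ratio A p" for p
    by (simp add: split_def)
  then have lower: "\<forall>\<^sub>F p in ?F. 0 \<le> density_ratio A p"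
    by (rule always_eventually[OF allI])
  show ?thesis
    using tendsto_sandwich[OF lower upper tendsto_const] assms(1)
    unfolding has_double_density_def by blast
qed

lemma has_double_density_Compl:
  assumes "has_double_density K d"
  shows "has_double_density (- K) (1 - d)"
proof -
  \<comment> \<open>If \<open>m\<close> or \<open>n\<close> is 0, division by zero makes both ratios
    0 and the identity would read 1 = 0. It therefore holds only eventually along the product
    filter.\<close>
  have ratio: "1 - density_ratio K (m, n) = density_ratio (- K) (m, n)" if "0 < m" "0 < n" for m n
  proof -
    let ?R = "{1..m} \<times> {1..n}"
    have "card ?R = card (K \<inter> ?R) + card (?R - K)"
      using card_Int_Diff[of ?R K] by (simp add: Int_commute)
    moreover have "- K \<inter> ?R = ?R - K"
      by auto
    ultimately have "real (card (- K \<inter> ?R)) = real m * real n - real (card (K \<inter> ?R))"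
      by (simp add: card_cartesian_product flip: of_nat_mult)
    then show ?thesis
      using that by (simp add: diff_divide_distrib)
  qed
  have "eventually (\<lambda>p. 1 - density_ratio K p = density_ratio (- K) p)
      (sequentially \<times>\<^sub>F sequentially)"
    using eventually_prodI[OF eventually_gt_at_top[of 0] eventually_gt_at_top[of 0]]
  proof (rule eventually_mono)
    fix p :: "nat \<times> nat"
    assume "0 < fst p \<and> 0 < snd p"
    then show "1 - density_ratio K p = density_ratio (- K) p"
      using ratio[of "fst p" "snd p"] by (simp only: prod.collapse)
  qed
  moreover have "((\<lambda>p. 1 - density_ratio K p) \<longlongrightarrow> 1 - d) (sequentially \<times>\<^sub>F sequentially)"
    using assms unfolding has_double_density_def by (intro tendsto_intros)
  ultimately show ?thesis
    unfolding has_double_density_def by (rule Lim_transform_eventually[rotated])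
qed

text \<open>Let \<open>a\<close> tend to 1 from the left: by continuity \<open>T a a\<close> tends
  to \<open>T 1 1\<close>, which is 1, and the bound by \<open>v\<close> survives the limit.\<close>

lemma (in t_norm) le_one_if_diagonal_le:
  assumes "\<And>a. 0 < a \<Longrightarrow> a < 1 \<Longrightarrow> T a a \<le> v"
  shows "1 \<le> v"
proof (rule tendsto_upperbound)
  have "continuous_on {0..1} (\<lambda>a. case (a, a) of (a, b) \<Rightarrow> T a b)"
    by (rule continuous_on_compose2[OF continuous]) (auto intro!: continuous_intros)
  then have "((\<lambda>a. T a a) \<longlongrightarrow> T 1 1) (at 1 within {0..1})"
    by (simp add: continuous_on_def)
  then show "((\<lambda>a. T a a) \<longlongrightarrow> 1) (at_left 1)"
    by (simp add: right_unit at_within_Icc_at_left)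
  show "eventually (\<lambda>a. T a a \<le> v) (at_left 1)"
    using eventually_at_left_real[of 0 1] by (rule eventually_mono) (use assms in auto)
qed simp

context prob_normed_space
begin

text \<open>The axioms of \<open>T\<close> speak only of arguments in the unit interval, so every
  use of them on values of \<open>\<nu>\<close> rests on this.\<close>

lemma mem_unit_interval: "\<nu> y t \<in> {0..1}"
proof -
  have "bdd_above (range (\<nu> y))" "(SUP t. \<nu> y t) = 1" "0 \<le> \<nu> y t"
    using distribution[of y] by (auto simp: distribution_functions_def)
  then show ?thesis
    using cSUP_upper[of t UNIV "\<nu> y"] by simp
qed

lemma prob_norm_diff_commute: "0 < t \<Longrightarrow> \<nu> (y - z) t = \<nu> (z - y) t"
  using scale[of "-1" t "z - y"] by simp

lemma triangle_diff:
  "0 \<le> s \<Longrightarrow> 0 \<le> t \<Longrightarrow> u = s + t \<Longrightarrow> T (\<nu> (y - z) t) (\<nu> (z - w) s) \<le> \<nu> (y - w) u"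
  using triangle[of s t "y - z" "z - w"] by simp

lemma rough_stat_limits_subset_cluster_points:
  "rough_stat_limits \<nu> r x \<subseteq> rough_stat_cluster_points \<nu> r x"
proof -
  have "has_double_density {(m, n). \<nu> (x m n - \<beta>) e > 1 - l} 1"
    if "has_double_density {(m, n). \<nu> (x m n - \<beta>) e \<le> 1 - l} 0" for \<beta> e l
  proof -
    have "- {(m, n). \<nu> (x m n - \<beta>) e \<le> 1 - l} = {(m, n). \<nu> (x m n - \<beta>) e > 1 - l}"
      by auto
    then show ?thesis
      using has_double_density_Compl[OF that] by simp
  qed
  then show ?thesis
    unfolding rough_stat_limits_def rough_stat_cluster_points_def
    by (blast intro: zero_less_one)
qed

lemma rough_stat_cluster_point_near_limit:
  assumes "stat_convergent \<nu> x \<eta>" "\<xi> \<in> rough_stat_cluster_points \<nu> r x" "0 \<le> r" "0 < \<epsilon>"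
  shows "\<nu> (\<eta> - \<xi>) (r + \<epsilon>) = 1"
proof -
  have "T a a \<le> \<nu> (\<eta> - \<xi>) (r + \<epsilon>)" if a: "0 < a" "a < 1" for a
  proof -
    \<comment> \<open>The slack \<open>\<epsilon>\<close> is split evenly between the two distances,
      and \<open>a\<close> is the level 1 - l with l = 1 - a.\<close>
    let ?A = "{(m, n). \<nu> (x m n - \<xi>) (r + \<epsilon> / 2) > a}"
    let ?B = "{(m, n). \<nu> (x m n - \<eta>) (\<epsilon> / 2) \<le> a}"
    have l: "1 - a \<in> {0<..<1}" "0 < \<epsilon> / 2"
      using a assms(4) by auto
    obtain d where d: "0 < d" "has_double_density ?A d"
      using assms(2) l unfolding rough_stat_cluster_points_def
      by (auto dest!: spec[of _ "\<epsilon> / 2"] bspec[of _ _ "1 - a"])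
    have "has_double_density ?B 0"
      using assms(1) l unfolding stat_convergent_def
      by (auto dest!: spec[of _ "\<epsilon> / 2"] bspec[of _ _ "1 - a"])
    \<comment> \<open>Otherwise \<open>?A\<close> would inherit density 0 from \<open>?B\<close>,
      against \<open>0 < d\<close>. An index in \<open>?A\<close> outside \<open>?B\<close> is close
      to both points.\<close>
    then have "\<not> ?A \<subseteq> ?B"
      using d has_double_density_unique has_double_density_zero_subset by (metis less_irrefl)
    then obtain m n where mn: "\<nu> (x m n - \<xi>) (r + \<epsilon> / 2) > a" "\<nu> (x m n - \<eta>) (\<epsilon> / 2) > a"
      by fastforce
    have "T a a \<le> T (\<nu> (\<eta> - x m n) (\<epsilon> / 2)) (\<nu> (x m n - \<xi>) (r + \<epsilon> / 2))"
      using mn a l mem_unit_interval by (intro mono) (auto simp: prob_norm_diff_commute[of _ \<eta>])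
    also have "\<dots> \<le> \<nu> (\<eta> - \<xi>) (r + \<epsilon>)"
      using assms(3,4) by (intro triangle_diff) auto
    finally show ?thesis .
  qed
  then have "1 \<le> \<nu> (\<eta> - \<xi>) (r + \<epsilon>)"
    by (rule le_one_if_diagonal_le)
  then show ?thesis
    using mem_unit_interval[of "\<eta> - \<xi>" "r + \<epsilon>"] by simp
qed

lemma rough_stat_cluster_points_subset_limits:
  assumes "stat_convergent \<nu> x \<eta>" "0 \<le> r"
  shows "rough_stat_cluster_points \<nu> r x \<subseteq> rough_stat_limits \<nu> r x"
proof
  fix \<xi> assume \<xi>: "\<xi> \<in> rough_stat_cluster_points \<nu> r x"
  have "has_double_density {(m, n). \<nu> (x m n - \<xi>) (r + \<epsilon>) \<le> 1 - l} 0"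
    if e: "0 < \<epsilon>" and l: "l \<in> {0<..<1}" for \<epsilon> l
  proof (rule has_double_density_zero_subset)
    show "has_double_density {(m, n). \<nu> (x m n - \<eta>) (\<epsilon> / 2) \<le> 1 - l} 0"
      using assms(1) e l by (simp add: stat_convergent_def)
    have "\<nu> (\<eta> - \<xi>) (r + \<epsilon> / 2) = 1"
      using rough_stat_cluster_point_near_limit[OF assms(1) \<xi> assms(2)] e by simp
    \<comment> \<open>One argument of \<open>T\<close> is exactly 1, the unit, so the triangle
      inequality loses nothing. The inclusion of exceptional sets below thus keeps the same level
      \<open>l\<close>.\<close>
    then have near: "\<nu> (x m n - \<eta>) (\<epsilon> / 2) \<le> \<nu> (x m n - \<xi>) (r + \<epsilon>)" for m n
      using triangle_diff[of "r + \<epsilon> / 2" "\<epsilon> / 2" "r + \<epsilon>" "x m n" \<eta> \<xi>] assms(2) e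
      by (simp add: right_unit[OF mem_unit_interval])
    show "{(m, n). \<nu> (x m n - \<xi>) (r + \<epsilon>) \<le> 1 - l}
        \<subseteq> {(m, n). \<nu> (x m n - \<eta>) (\<epsilon> / 2) \<le> 1 - l}"
      by (auto dest: order_trans[OF near])
  qed
  then show "\<xi> \<in> rough_stat_limits \<nu> r x"
    by (simp add: rough_stat_limits_def)
qed

lemma rough_stat_cluster_points_eq_limits:
  assumes "stat_convergent \<nu> x \<eta>" "0 \<le> r"
  shows "rough_stat_cluster_points \<nu> r x = rough_stat_limits \<nu> r x"
  using rough_stat_cluster_points_subset_limits[OF assms] rough_stat_limits_subset_cluster_points
  by (rule equalityI)

end

theorem theorem3p13:
  fixes \<nu> :: "'a::real_vector \<Rightarrow> real \<Rightarrow> real"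
    and T :: "real \<Rightarrow> real \<Rightarrow> real"
    and x :: "nat \<Rightarrow> nat \<Rightarrow> 'a"
    and \<eta> :: 'a
  assumes "prob_normed_space \<nu> T"
    and "stat_convergent \<nu> x \<eta>"
  shows "\<exists>r>0. rough_stat_cluster_points \<nu> r x = rough_stat_limits \<nu> r x"
  \<comment> \<open>The witness 1 is arbitrary: the equality holds for every nonnegative
    \<open>r\<close>.\<close>
  using prob_normed_space.rough_stat_cluster_points_eq_limits[OF assms, of 1]
  by (intro exI[of _ 1]) simp

end
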